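(* Let $X$ be a completely regular topometric space. Then $X$ admits a compactification $\beta X$ with the following universal property: every continuous $1$-Lipschitz function $f\colon X\to[0,\infty]$ extends to a continuous $1$-Lipschitz function on $\beta X$, and this extension is unique. Moreover, $\beta X$ is unique up to a unique isomorphism (i.e., an isometric homeomorphism fixing $X$), and it satisfies the same universal property with $[0,\infty]$ replaced by any compact topometric space $Y$: every continuous $1$-Lipschitz map $X\to Y$ extends uniquely to a continuous $1$-Lipschitz map $\beta X\to Y$.
   Context: A topometric space is a triple $(X,\mathcal T,d)$ where $\mathcal T$ is a topology on $X$ and $d\colon X\times X\to[0,\infty]$ is a metric (possibly taking the value $\infty$) such that $d$ is lower semi-continuous with respect to $\mathcal T\times\mathcal T$ and every $\mathcal T$-open set is open in the metric topology of $d$. Unqualified topological terms refer to $\mathcal T$, metric terms to $d$. A map $f$ between topometric spaces is $1$-Lipschitz if $d(f(x),f(y))\le d(x,y)$. $[0,\infty]$ carries the usual topology of the extended half-line and the metric $|s-t|$, with $d(\infty,t)=\infty$ for $t<\infty$ and $d(\infty,\infty)=0$; $\mathbb C$ carries its usual metric and topology. For topometric spaces $X,Y$, $\mathcal C_{\mathcal L(1)}(X,Y)$ denotes the set of continuous $1$-Lipschitz maps $X\to Y$, and $\mathcal C_{\mathcal L(1)}(X)=\mathcal C_{\mathcal L(1)}(X,\mathbb C)$. A family $\mathcal F$ of functions $X\to\mathbb C$ separates points from closed sets if for every closed $F\subseteq X$ and $x\in X\setminus F$ some $f\in\mathcal F$ is constant on $F$ and takes a different value at $x$. A topometric space $X$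 is completely regular if $\mathcal C_{\mathcal L(1)}(X)$ separates points from closed sets and $d(x,y)=\sup\{|f(x)-f(y)|: f\in\mathcal C_{\mathcal L(1)}(X)\}$ for all $x,y\in X$. A subset of a topometric space carries the induced topology and restricted metric; an embedding is an isometric map that is a homeomorphism onto its image. A compactification of $X$ is a compact topometric space containing (an embedded copy of) $X$ as a topologically dense subspace. *)

theory Defs
  imports "HOL-Analysis.Analysis"
begin

text \<open>
  The metric of a topometric space may be infinite, so \<open>Metric_space\<close> (whose distance is
  real-valued) does not apply; distances are taken in \<open>ennreal\<close>. The underlying set is the
  \<open>topspace\<close> of the topology, and the values of the distance outside it are irrelevant.
\<close>

record 'a topometric =
  tm_top :: "'a topology"
  tm_dist :: "'a \<Rightarrow> 'a \<Rightarrow> ennreal"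

abbreviation tm_space :: "'a topometric \<Rightarrow> 'a set"
  where "tm_space X \<equiv> topspace (tm_top X)"

definition extended_metric_on :: "'a set \<Rightarrow> ('a \<Rightarrow> 'a \<Rightarrow> ennreal) \<Rightarrow> bool"
  where "extended_metric_on S d \<longleftrightarrow>
    (\<forall>x\<in>S. \<forall>y\<in>S. d x y = 0 \<longleftrightarrow> x = y) \<and>
    (\<forall>x\<in>S. \<forall>y\<in>S. d x y = d y x) \<and>
    (\<forall>x\<in>S. \<forall>y\<in>S. \<forall>z\<in>S. d x z \<le> d x y + d y z)"

definition metric_open_in :: "'a set \<Rightarrow> ('a \<Rightarrow> 'a \<Rightarrow> ennreal) \<Rightarrow> 'a set \<Rightarrow> bool"
  where "metric_open_in S d U \<longleftrightarrow>
    U \<subseteq> S \<and> (\<forall>x\<in>U. \<exists>\<epsilon>>0. \<forall>y\<in>S. d x y < \<epsilon> \<longrightarrow> y \<in> U)"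

definition lower_semicontinuous_map :: "'a topology \<Rightarrow> ('a \<Rightarrow> ennreal) \<Rightarrow> bool"
  where "lower_semicontinuous_map T f \<longleftrightarrow> (\<forall>r. openin T {x \<in> topspace T. r < f x})"

text \<open>
  Such a space is automatically Hausdorff, as \<open>d x y = 0\<close> defines a closed set; hence no
  separation axiom is added to compactness below.
\<close>

definition topometric_space :: "'a topometric \<Rightarrow> bool"
  where "topometric_space X \<longleftrightarrow>
    extended_metric_on (tm_space X) (tm_dist X) \<and>
    lower_semicontinuous_map (prod_topology (tm_top X) (tm_top X)) (\<lambda>(x, y). tm_dist X x y) \<and>
    (\<forall>U. openin (tm_top X) U \<longrightarrow> metric_open_in (tm_space X) (tm_dist X) U)"

definition compact_topometric_space :: "'a topometric \<Rightarrow> bool"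
  where "compact_topometric_space X \<longleftrightarrow> topometric_space X \<and> compact_space (tm_top X)"

text \<open>
  Maps are made \<open>extensional\<close> so that two of them are equal in HOL exactly when they agree on
  the underlying set; uniqueness can then be expressed by \<open>\<exists>!\<close>.
\<close>

definition C_L1 :: "'a topometric \<Rightarrow> 'b topometric \<Rightarrow> ('a \<Rightarrow> 'b) set"
  where "C_L1 X Y = {f \<in> extensional (tm_space X).
    continuous_map (tm_top X) (tm_top Y) f \<and>
    (\<forall>x\<in>tm_space X. \<forall>y\<in>tm_space X. tm_dist Y (f x) (f y) \<le> tm_dist X x y)}"

definition complex_tm :: "complex topometric"
  where "complex_tm = \<lparr>tm_top = euclidean, tm_dist = (\<lambda>s t. ennreal (cmod (s - t)))\<rparr>"

text \<open>Infinite arguments are treated separately: \<open>\<infinity> - \<infinity> = \<infinity>\<close> in \<open>ennreal\<close>, and \<open>enn2real \<infinity> = 0\<close>.\<close>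

definition ennreal_tm :: "ennreal topometric"
  where "ennreal_tm = \<lparr>tm_top = euclidean, tm_dist = (\<lambda>s t.
    if s < \<infinity> \<and> t < \<infinity> then ennreal \<bar>enn2real s - enn2real t\<bar>
    else if s = t then 0 else \<infinity>)\<rparr>"

definition separates_points_from_closed_sets :: "'a topology \<Rightarrow> ('a \<Rightarrow> complex) set \<Rightarrow> bool"
  where "separates_points_from_closed_sets T \<F> \<longleftrightarrow>
    (\<forall>F x. closedin T F \<and> x \<in> topspace T - F \<longrightarrow>
      (\<exists>f\<in>\<F>. \<exists>c. (\<forall>y\<in>F. f y = c) \<and> f x \<noteq> c))"

definition completely_regular_topometric :: "'a topometric \<Rightarrow> bool"
  where "completely_regular_topometric X \<longleftrightarrow>
    topometric_space X \<and>
    separates_points_from_closed_sets (tm_top X) (C_L1 X complex_tm) \<and>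
    (\<forall>x\<in>tm_space X. \<forall>y\<in>tm_space X.
      tm_dist X x y = (SUP f\<in>C_L1 X complex_tm. ennreal (cmod (f x - f y))))"

definition isometric_on :: "'a topometric \<Rightarrow> 'b topometric \<Rightarrow> ('a \<Rightarrow> 'b) \<Rightarrow> bool"
  where "isometric_on X Y f \<longleftrightarrow>
    (\<forall>x\<in>tm_space X. \<forall>y\<in>tm_space X. tm_dist Y (f x) (f y) = tm_dist X x y)"

definition tm_embedding :: "'a topometric \<Rightarrow> 'b topometric \<Rightarrow> ('a \<Rightarrow> 'b) \<Rightarrow> bool"
  where "tm_embedding X Y e \<longleftrightarrow>
    embedding_map (tm_top X) (tm_top Y) e \<and> isometric_on X Y e"

definition tm_isomorphisms :: "'a topometric \<Rightarrow> 'b topometric \<Rightarrow> ('a \<Rightarrow> 'b) set"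
  where "tm_isomorphisms X Y = {\<phi> \<in> extensional (tm_space X).
    homeomorphic_map (tm_top X) (tm_top Y) \<phi> \<and> isometric_on X Y \<phi>}"

definition tm_compactification :: "'a topometric \<Rightarrow> 'b topometric \<Rightarrow> ('a \<Rightarrow> 'b) \<Rightarrow> bool"
  where "tm_compactification X B e \<longleftrightarrow>
    compact_topometric_space B \<and> tm_embedding X B e \<and>
    tm_top B closure_of (e ` tm_space X) = tm_space B"

definition unique_extension_property ::
    "'a topometric \<Rightarrow> 'b topometric \<Rightarrow> ('a \<Rightarrow> 'b) \<Rightarrow> 'c topometric \<Rightarrow> bool"
  where "unique_extension_property X B e Y \<longleftrightarrow>
    (\<forall>f\<in>C_L1 X Y. \<exists>!g. g \<in> C_L1 B Y \<and> (\<forall>x\<in>tm_space X. g (e x) = f x))"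

definition is_beta :: "'a topometric \<Rightarrow> 'b topometric \<Rightarrow> ('a \<Rightarrow> 'b) \<Rightarrow> bool"
  where "is_beta X B e \<longleftrightarrow>
    tm_compactification X B e \<and> unique_extension_property X B e ennreal_tm"

end

theory Submission
  imports Defs
begin

text \<open>
  Let \<open>F\<close> be the set of continuous 1-Lipschitz functions \<open>X \<rightarrow> [0,\<infinity>]\<close>. The cube \<open>[0,\<infinity>]\<^sup>F\<close>, with the
  product topology and the supremum distance, is a compact topometric space, and \<open>\<beta>X\<close> is the
  closure in it of the image of \<open>X\<close> under evaluation; the functions \<open>|f - c|\<close> with
  \<open>f : X \<rightarrow> \<complex>\<close> continuous and 1-Lipschitz show that evaluation is an embedding, and coordinate
  projections extend the members of \<open>F\<close>. To extend maps into a compact \<open>Y\<close>, one embeds \<open>Y\<close> as a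
  closed subset of its own cube. This is possible because on \<open>Y\<close> the distance of two points is the
  supremum of the distances of their images under continuous 1-Lipschitz functions, by a metric
  version of Urysohn's lemma: in compact \<open>Y\<close> the closed \<open>r\<close>-neighbourhood of a closed set is closed,
  so that the sublevel sets of the function can be chosen one rational at a time. The isomorphism
  between two such compactifications is the extension of the embedding of \<open>X\<close>.
\<close>

section \<open>The metric of the extended half-line\<close>

lemma ennreal_tm_top [simp]: "tm_top ennreal_tm = euclidean"
  by (simp add: ennreal_tm_def)

text \<open>Replaces the case distinction at infinity by two inequalities between sums, which make
  sense for all values. The metric axioms and lower semicontinuity on the half-line are derived from
  this form.\<close>

lemma ennreal_tm_dist_le_iff: "tm_dist ennreal_tm s t \<le> r \<longleftrightarrow> s \<le> t + r \<and> t \<le> s + r"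
proof (cases s; cases t; cases r)
  fix a b c :: real
  assume "s = ennreal a" "0 \<le> a" "t = ennreal b" "0 \<le> b" "r = ennreal c" "0 \<le> c"
  then show ?thesis
    by (auto simp: ennreal_tm_def abs_le_iff simp flip: ennreal_plus)
qed (auto simp: ennreal_tm_def top_unique)

lemma ennreal_tm_dist_le_add: "s \<le> t + tm_dist ennreal_tm s t"
  using ennreal_tm_dist_le_iff by blast

lemma ennreal_tm_dist_sym: "tm_dist ennreal_tm s t = tm_dist ennreal_tm t s"
  by (meson antisym ennreal_tm_dist_le_iff order_refl)

lemma ennreal_tm_dist_eq_0_iff: "tm_dist ennreal_tm s t = 0 \<longleftrightarrow> s = t"
  using ennreal_tm_dist_le_iff[of s t 0] by (auto simp: antisym)

lemma ennreal_tm_dist_triangle: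
  "tm_dist ennreal_tm s u \<le> tm_dist ennreal_tm s t + tm_dist ennreal_tm t u"
proof -
  let ?d = "tm_dist ennreal_tm"
  have "s \<le> t + ?d s t" "t \<le> u + ?d t u" "u \<le> t + ?d t u" "t \<le> s + ?d s t"
    using ennreal_tm_dist_le_add ennreal_tm_dist_sym by metis+
  then have "s \<le> u + (?d s t + ?d t u)" "u \<le> s + (?d s t + ?d t u)"
    using add_right_mono[of t "u + ?d t u" "?d s t"] add_right_mono[of t "s + ?d s t" "?d t u"]
    by (auto simp: ac_simps intro: order_trans)
  then show ?thesis
    by (simp add: ennreal_tm_dist_le_iff)
qed

text \<open>Lower semicontinuity of the half-line metric: the distance exceeds \<open>r\<close> when
  one of two strict inequalities between continuous functions holds.\<close>

lemma open_ennreal_tm_dist_greater: "open {p. r < tm_dist ennreal_tm (fst p) (snd p)}"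
proof -
  have "{p. r < tm_dist ennreal_tm (fst p) (snd p)} = {p. snd p + r < fst p} \<union> {p. fst p + r < snd p}"
    by (auto simp: not_le[symmetric] ennreal_tm_dist_le_iff)
  also have "open \<dots>"
    by (intro open_Un open_Collect_less continuous_on_add continuous_on_fst continuous_on_snd
        continuous_on_id continuous_on_const)
  finally show ?thesis .
qed

text \<open>Open rays generate the order topology, so their preimages suffice. This fits functions
  that are known only through their sublevel and superlevel sets, such as the Urysohn function
  below.\<close>

lemma continuous_map_into_order_topology:
  fixes f :: "'a \<Rightarrow> 'b::order_topology"
  assumes lt: "\<And>a. openin T {x \<in> topspace T. f x < a}"
    and gt: "\<And>a. openin T {x \<in> topspace T. a < f x}"
  shows "continuous_map T euclidean f"
proof -
  have "openin T {x \<in> topspace T. f x \<in> U}" if "open U" for U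
  proof -
    have "generate_topology (range (\<lambda>a. {..<a}) \<union> range (\<lambda>a. {a<..})) U"
      using that by (simp add: open_generated_order)
    then show ?thesis
    proof induction
      case UNIV
      then show ?case by simp
    next
      case (Int a b)
      then have "openin T ({x \<in> topspace T. f x \<in> a} \<inter> {x \<in> topspace T. f x \<in> b})"
        by blast
      moreover have "{x \<in> topspace T. f x \<in> a} \<inter> {x \<in> topspace T. f x \<in> b} =
          {x \<in> topspace T. f x \<in> a \<inter> b}"
        by blast
      ultimately show ?case by simp
    next
      case (UN K)
      then have "openin T (\<Union>k\<in>K. {x \<in> topspace T. f x \<in> k})"
        by blast
      moreover have "(\<Union>k\<in>K. {x \<in> topspace T. f x \<in> k}) = {x \<in> topspace T. f x \<in> \<Union>K}"
        by blast
      ultimately show ?case by simp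
    next
      case (Basis s)
      then show ?case using lt gt by auto
    qed
  qed
  then show ?thesis by (simp add: continuous_map_def)
qed

section \<open>Topometric spaces\<close>

lemma topometric_dist_eq_0:
  "topometric_space X \<Longrightarrow> x \<in> tm_space X \<Longrightarrow> y \<in> tm_space X \<Longrightarrow> tm_dist X x y = 0 \<longleftrightarrow> x = y"
  by (auto simp: topometric_space_def extended_metric_on_def)

lemma topometric_dist_sym:
  "topometric_space X \<Longrightarrow> x \<in> tm_space X \<Longrightarrow> y \<in> tm_space X \<Longrightarrow> tm_dist X x y = tm_dist X y x"
  unfolding topometric_space_def extended_metric_on_def by blast

lemma topometric_dist_triangle:
  "topometric_space X \<Longrightarrow> x \<in> tm_space X \<Longrightarrow> y \<in> tm_space X \<Longrightarrow> z \<in> tm_space X \<Longrightarrow>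
    tm_dist X x z \<le> tm_dist X x y + tm_dist X y z"
  unfolding topometric_space_def extended_metric_on_def by blast

lemma topometric_closedin_dist_le:
  assumes "topometric_space X"
  shows "closedin (prod_topology (tm_top X) (tm_top X))
    {p \<in> tm_space X \<times> tm_space X. tm_dist X (fst p) (snd p) \<le> r}"
proof -
  have "openin (prod_topology (tm_top X) (tm_top X))
      {p \<in> tm_space X \<times> tm_space X. r < tm_dist X (fst p) (snd p)}"
    using assms by (auto simp: topometric_space_def lower_semicontinuous_map_def case_prod_unfold)
  moreover have "tm_space X \<times> tm_space X - {p \<in> tm_space X \<times> tm_space X. tm_dist X (fst p) (snd p) \<le> r}
      = {p \<in> tm_space X \<times> tm_space X. r < tm_dist X (fst p) (snd p)}"
    by (auto simp: not_le)
  ultimately show ?thesis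
    by (auto simp: closedin_def)
qed

text \<open>The diagonal is the sublevel set of the distance at 0, closed by lower
  semicontinuity.\<close>

lemma topometric_Hausdorff:
  assumes "topometric_space X"
  shows "Hausdorff_space (tm_top X)"
proof -
  have "(\<lambda>x. (x, x)) ` tm_space X = {p \<in> tm_space X \<times> tm_space X. tm_dist X (fst p) (snd p) \<le> 0}"
    using topometric_dist_eq_0[OF assms] by force
  then show ?thesis
    using topometric_closedin_dist_le[OF assms, of 0] by (simp add: Hausdorff_space_closedin_diagonal)
qed

lemma C_L1_iff:
  "f \<in> C_L1 X Y \<longleftrightarrow> f \<in> extensional (tm_space X) \<and> continuous_map (tm_top X) (tm_top Y) f \<and>
    (\<forall>x\<in>tm_space X. \<forall>y\<in>tm_space X. tm_dist Y (f x) (f y) \<le> tm_dist X x y)"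
  by (simp add: C_L1_def)

lemma C_L1_restrict:
  assumes "continuous_map (tm_top X) (tm_top Y) f"
    and "\<And>x y. x \<in> tm_space X \<Longrightarrow> y \<in> tm_space X \<Longrightarrow> tm_dist Y (f x) (f y) \<le> tm_dist X x y"
  shows "restrict f (tm_space X) \<in> C_L1 X Y"
  unfolding C_L1_iff
  by (intro conjI ballI) (auto simp: assms intro: continuous_map_eq[OF assms(1)])

lemma C_L1_continuous: "f \<in> C_L1 X Y \<Longrightarrow> continuous_map (tm_top X) (tm_top Y) f"
  by (simp add: C_L1_iff)

lemma C_L1_dist_le:
  "f \<in> C_L1 X Y \<Longrightarrow> x \<in> tm_space X \<Longrightarrow> y \<in> tm_space X \<Longrightarrow> tm_dist Y (f x) (f y) \<le> tm_dist X x y"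
  by (simp add: C_L1_iff)

lemma C_L1_mem: "f \<in> C_L1 X Y \<Longrightarrow> x \<in> tm_space X \<Longrightarrow> f x \<in> tm_space Y"
  by (auto simp: C_L1_iff continuous_map_def)

lemma C_L1_compose:
  assumes f: "f \<in> C_L1 X Y" and g: "g \<in> C_L1 Y Z"
  shows "compose (tm_space X) g f \<in> C_L1 X Z"
  unfolding compose_def
proof (rule C_L1_restrict)
  show "continuous_map (tm_top X) (tm_top Z) (\<lambda>x. g (f x))"
    using continuous_map_compose[OF C_L1_continuous[OF f] C_L1_continuous[OF g]] by (simp add: o_def)
  show "tm_dist Z (g (f x)) (g (f y)) \<le> tm_dist X x y"
    if "x \<in> tm_space X" "y \<in> tm_space X" for x y
    using that f g by (meson C_L1_dist_le C_L1_mem order_trans)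
qed

text \<open>The source of all uniqueness claims: maps into a Hausdorff space are determined on a
  dense set, and extensionality turns agreement on the space into equality.\<close>

lemma C_L1_eq_on_dense:
  assumes "f \<in> C_L1 B Y" "g \<in> C_L1 B Y" "Hausdorff_space (tm_top Y)"
    and dense: "tm_top B closure_of S = tm_space B"
    and eq: "\<And>x. x \<in> S \<Longrightarrow> f x = g x"
  shows "f = g"
proof (rule extensionalityI)
  show "f \<in> extensional (tm_space B)" "g \<in> extensional (tm_space B)"
    using assms by (auto simp: C_L1_iff)
  show "f x = g x" if "x \<in> tm_space B" for x
    using assms that
    by (intro forall_in_closure_of_eq[of x "tm_top B" S "tm_top Y" f g]) (auto simp: C_L1_iff)
qed

text \<open>Lets the extension property be applied to an embedding. The restriction is there because
  \<open>tm_embedding\<close> says nothing about values outside the space, whereas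
  \<open>C_L1\<close> fixes them.\<close>

lemma tm_embedding_C_L1:
  assumes "tm_embedding X B e"
  shows "restrict e (tm_space X) \<in> C_L1 X B"
  using assms homeomorphic_imp_continuous_map
  by (intro C_L1_restrict) (fastforce simp: tm_embedding_def isometric_on_def embedding_map_def continuous_map_in_subtopology)+

section \<open>Cubes\<close>

definition cube_tm :: "'i set \<Rightarrow> ('i \<Rightarrow> ennreal) topometric"
  where "cube_tm F = \<lparr>tm_top = product_topology (\<lambda>_. euclidean) F,
    tm_dist = (\<lambda>p q. SUP i\<in>F. tm_dist ennreal_tm (p i) (q i))\<rparr>"

lemma cube_tm_top: "tm_top (cube_tm F) = product_topology (\<lambda>_. euclidean) F"
  by (simp add: cube_tm_def)

lemma cube_tm_dist: "tm_dist (cube_tm F) p q = (SUP i\<in>F. tm_dist ennreal_tm (p i) (q i))"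
  by (simp add: cube_tm_def)

lemma cube_tm_space: "tm_space (cube_tm F) = extensional F"
  by (auto simp: cube_tm_top PiE_def)

section \<open>The topology of an extended metric\<close>

text \<open>With the metric topology as an object, the requirement that open sets be metrically open
  becomes continuity of the identity, which for a product can be checked coordinate by
  coordinate.\<close>

definition metric_topology :: "'a set \<Rightarrow> ('a \<Rightarrow> 'a \<Rightarrow> ennreal) \<Rightarrow> 'a topology"
  where "metric_topology S d = topology (metric_open_in S d)"

lemma openin_metric_topology: "openin (metric_topology S d) = metric_open_in S d"
proof -
  have "istopology (metric_open_in S d)"
    unfolding istopology_def
  proof (intro conjI allI impI)
    fix U V assume U: "metric_open_in S d U" and V: "metric_open_in S d V"
    show "metric_open_in S d (U \<inter> V)"
      unfolding metric_open_in_def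
    proof (intro conjI ballI)
      show "U \<inter> V \<subseteq> S" using U by (auto simp: metric_open_in_def)
      fix x assume "x \<in> U \<inter> V"
      then obtain a b where "a > 0" "\<forall>y\<in>S. d x y < a \<longrightarrow> y \<in> U" "b > 0" "\<forall>y\<in>S. d x y < b \<longrightarrow> y \<in> V"
        using U V by (auto simp: metric_open_in_def) blast
      then show "\<exists>\<epsilon>>0. \<forall>y\<in>S. d x y < \<epsilon> \<longrightarrow> y \<in> U \<inter> V"
        by (intro exI[of _ "min a b"]) auto
    qed
  next
    fix \<K> assume "\<forall>K\<in>\<K>. metric_open_in S d K"
    then show "metric_open_in S d (\<Union>\<K>)"
      unfolding metric_open_in_def by (meson Sup_least UnionE UnionI)
  qed
  then show ?thesis
    by (simp add: metric_topology_def topology_inverse')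
qed

lemma topspace_metric_topology [simp]: "topspace (metric_topology S d) = S"
proof -
  have "metric_open_in S d S"
    unfolding metric_open_in_def using zero_less_one by blast
  moreover have "U \<subseteq> S" if "metric_open_in S d U" for U
    using that by (simp add: metric_open_in_def)
  ultimately show ?thesis
    unfolding topspace_def openin_metric_topology by blast
qed

lemma continuous_map_metric_topology_ennreal:
  assumes "\<And>x y. x \<in> S \<Longrightarrow> y \<in> S \<Longrightarrow> tm_dist ennreal_tm (f x) (f y) \<le> d x y"
  shows "continuous_map (metric_topology S d) euclidean f"
proof (rule continuous_map_into_order_topology)
  fix a
  have 1: "f y \<le> f x + d x y" "f x \<le> f y + d x y" if "x \<in> S" "y \<in> S" for x y
    using assms[OF that] by (auto simp: ennreal_tm_dist_le_iff)
  show "openin (metric_topology S d) {x \<in> topspace (metric_topology S d). f x < a}"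
    unfolding openin_metric_topology topspace_metric_topology metric_open_in_def
  proof (intro conjI ballI)
    fix x assume "x \<in> {x \<in> S. f x < a}"
    then have x: "x \<in> S" "f x < a" by auto
    \<comment> \<open>The Lipschitz bound yields only \<open>f y \<le> b\<close>; the gap between
      \<open>b\<close> and \<open>a\<close> keeps the conclusion strict.\<close>
    then obtain b where b: "f x < b" "b < a" using dense by blast
    have "y \<in> {x \<in> S. f x < a}" if y: "y \<in> S" "d x y < b - f x" for y
    proof -
      have "f y \<le> f x + (b - f x)"
        using 1(1)[OF x(1) y(1)] y(2) by (meson add_left_mono less_imp_le order_trans)
      also have "\<dots> = b" using b by (simp add: less_imp_le)
      finally show ?thesis using b y by auto
    qed
    moreover have "0 < b - f x" using b by (simp add: diff_gr0_ennreal)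
    ultimately show "\<exists>\<epsilon>>0. \<forall>y\<in>S. d x y < \<epsilon> \<longrightarrow> y \<in> {x \<in> S. f x < a}" by blast
  qed auto
  show "openin (metric_topology S d) {x \<in> topspace (metric_topology S d). a < f x}"
    unfolding openin_metric_topology topspace_metric_topology metric_open_in_def
  proof (intro conjI ballI)
    fix x assume "x \<in> {x \<in> S. a < f x}"
    then have x: "x \<in> S" "a < f x" by auto
    then obtain b where b: "a < b" "b < f x" using dense by blast
    have "y \<in> {x \<in> S. a < f x}" if y: "y \<in> S" "d x y < b - a" for y
    proof (rule ccontr)
      assume "\<not> ?thesis"
      then have "f y \<le> a" using y by auto
      then have "f x \<le> a + (b - a)"
        using 1(2)[OF x(1) y(1)] y(2) by (meson add_mono less_imp_le order_trans)
      also have "\<dots> = b" using b by (simp add: less_imp_le)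
      finally show False using b by auto
    qed
    moreover have "0 < b - a" using b by (simp add: diff_gr0_ennreal)
    ultimately show "\<exists>\<epsilon>>0. \<forall>y\<in>S. d x y < \<epsilon> \<longrightarrow> y \<in> {x \<in> S. a < f x}" by blast
  qed auto
qed

lemma cube_tm_dist_coordinate:
  "i \<in> F \<Longrightarrow> tm_dist ennreal_tm (p i) (q i) \<le> tm_dist (cube_tm F) p q"
  by (auto simp: cube_tm_dist intro: SUP_upper)

text \<open>A supremum of lower semicontinuous functions is lower semicontinuous, the coordinates
  are 1-Lipschitz for the supremum distance, and compactness is Tychonoff's theorem.\<close>

lemma compact_topometric_cube: "compact_topometric_space (cube_tm F)"
proof -
  let ?T = "tm_top (cube_tm F)" and ?d = "tm_dist (cube_tm F)" and ?S = "extensional F"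
  have "extended_metric_on ?S ?d"
    unfolding extended_metric_on_def
  proof (intro conjI ballI)
    fix p q :: "'a \<Rightarrow> ennreal"
    assume pq: "p \<in> ?S" "q \<in> ?S"
    have "?d p q = 0 \<longleftrightarrow> (\<forall>i\<in>F. p i = q i)"
      by (simp add: cube_tm_dist SUP_bot_conv ennreal_tm_dist_eq_0_iff flip: bot_ennreal)
        (simp add: bot_ennreal ennreal_tm_dist_eq_0_iff)
    also have "\<dots> \<longleftrightarrow> p = q" using pq by (auto intro: extensionalityI)
    finally show "?d p q = 0 \<longleftrightarrow> p = q" .
    show "?d p q = ?d q p" by (simp add: cube_tm_dist ennreal_tm_dist_sym)
  next
    fix p q r :: "'a \<Rightarrow> ennreal"
    show "?d p r \<le> ?d p q + ?d q r"
      unfolding cube_tm_dist[of F p r]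
    proof (rule SUP_least)
      fix i assume "i \<in> F"
      then show "tm_dist ennreal_tm (p i) (r i) \<le> ?d p q + ?d q r"
        using ennreal_tm_dist_triangle[of "p i" "r i" "q i"]
          add_mono[OF cube_tm_dist_coordinate[of i F p q] cube_tm_dist_coordinate[of i F q r]]
        by (blast intro: order_trans)
    qed
  qed
  moreover have "lower_semicontinuous_map (prod_topology ?T ?T) (\<lambda>(p, q). ?d p q)"
    unfolding lower_semicontinuous_map_def
  proof
    fix r
    let ?P = "prod_topology ?T ?T"
    have "openin ?P {z \<in> topspace ?P. (fst z i, snd z i) \<in> {p. r < tm_dist ennreal_tm (fst p) (snd p)}}"
      if "i \<in> F" for i
    proof (rule openin_continuous_map_preimage)
      have "continuous_map ?T euclidean (\<lambda>x. x i)"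
        using that continuous_map_product_projection[of i F "\<lambda>_. euclidean"] by (simp add: cube_tm_top)
      then show "continuous_map ?P (prod_topology euclidean euclidean) (\<lambda>z. (fst z i, snd z i))"
        using continuous_map_compose[OF continuous_map_fst, of ?T euclidean "\<lambda>x. x i" ?T]
          continuous_map_compose[OF continuous_map_snd, of ?T euclidean "\<lambda>x. x i" ?T]
        unfolding continuous_map_pairwise by (simp add: o_def)
      show "openin (prod_topology euclidean euclidean) {p. r < tm_dist ennreal_tm (fst p) (snd p)}"
        using open_ennreal_tm_dist_greater by (simp add: euclidean_product_topology)
    qed
    then have "openin ?P (\<Union>i\<in>F. {z \<in> topspace ?P. r < tm_dist ennreal_tm (fst z i) (snd z i)})"
      by auto
    moreover have "{z \<in> topspace ?P. r < (case z of (p, q) \<Rightarrow> ?d p q)} =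
        (\<Union>i\<in>F. {z \<in> topspace ?P. r < tm_dist ennreal_tm (fst z i) (snd z i)})"
      by (auto simp: cube_tm_dist less_SUP_iff)
    ultimately show "openin ?P {z \<in> topspace ?P. r < (case z of (p, q) \<Rightarrow> ?d p q)}"
      by simp
  qed
  moreover have "metric_open_in ?S ?d U" if "openin ?T U" for U
  proof -
    \<comment> \<open>Each coordinate is 1-Lipschitz, hence continuous for the metric topology, so
      the identity into the product is continuous.\<close>
    have "continuous_map (metric_topology ?S ?d) ?T id"
      by (auto simp: cube_tm_top continuous_map_componentwise cube_tm_dist_coordinate
          intro!: continuous_map_metric_topology_ennreal)
    then have "openin (metric_topology ?S ?d) {x \<in> topspace (metric_topology ?S ?d). id x \<in> U}"
      using that openin_continuous_map_preimage by blast
    moreover have "{x \<in> ?S. x \<in> U} = U" using openin_subset[OF that] by (auto simp: cube_tm_space)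
    ultimately show ?thesis by (simp add: openin_metric_topology)
  qed
  moreover have "compact_space ?T"
  proof -
    have "compact_space (euclidean :: ennreal topology)"
      unfolding compact_space_def by (simp add: compact_UNIV)
    then show ?thesis
      unfolding cube_tm_top compact_space_product_topology by simp
  qed
  ultimately show ?thesis
    by (simp add: compact_topometric_space_def topometric_space_def cube_tm_space)
qed

section \<open>Subspaces\<close>

definition tm_subspace :: "'a topometric \<Rightarrow> 'a set \<Rightarrow> 'a topometric"
  where "tm_subspace X S = \<lparr>tm_top = subtopology (tm_top X) S, tm_dist = tm_dist X\<rparr>"

lemma tm_subspace_simps [simp]:
  "tm_top (tm_subspace X S) = subtopology (tm_top X) S" "tm_dist (tm_subspace X S) = tm_dist X"
  by (simp_all add: tm_subspace_def)

lemma topometric_subspace: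
  assumes X: "topometric_space X"
  shows "topometric_space (tm_subspace X S)"
  unfolding topometric_space_def tm_subspace_simps
proof (intro conjI allI impI)
  let ?T = "subtopology (tm_top X) S"
  show "extended_metric_on (topspace ?T) (tm_dist X)"
    using X unfolding topometric_space_def extended_metric_on_def by simp
  show "lower_semicontinuous_map (prod_topology ?T ?T) (\<lambda>(x, y). tm_dist X x y)"
    unfolding lower_semicontinuous_map_def
  proof
    fix r
    let ?P = "prod_topology (tm_top X) (tm_top X)"
    have "openin ?P {z \<in> topspace ?P. r < (case z of (x, y) \<Rightarrow> tm_dist X x y)}"
      using X unfolding topometric_space_def lower_semicontinuous_map_def by blast
    then have "openin (subtopology ?P (S \<times> S))
        ({z \<in> topspace ?P. r < (case z of (x, y) \<Rightarrow> tm_dist X x y)} \<inter> S \<times> S)"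
      by (rule openin_subtopology_Int)
    moreover have "{z \<in> topspace ?P. r < (case z of (x, y) \<Rightarrow> tm_dist X x y)} \<inter> S \<times> S =
        {z \<in> topspace (prod_topology ?T ?T). r < (case z of (x, y) \<Rightarrow> tm_dist X x y)}"
      by auto
    ultimately show "openin (prod_topology ?T ?T)
        {z \<in> topspace (prod_topology ?T ?T). r < (case z of (x, y) \<Rightarrow> tm_dist X x y)}"
      by (simp add: subtopology_Times)
  qed
  fix U assume "openin ?T U"
  then obtain V where V: "openin (tm_top X) V" "U = V \<inter> S" by (auto simp: openin_subtopology)
  with X have "metric_open_in (tm_space X) (tm_dist X) V" by (auto simp: topometric_space_def)
  show "metric_open_in (topspace ?T) (tm_dist X) U"
    unfolding metric_open_in_def
  proof (intro conjI ballI)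
    show "U \<subseteq> topspace ?T"
      using V openin_subset by auto
    fix x assume "x \<in> U"
    with V \<open>metric_open_in _ _ V\<close> obtain \<epsilon> where "\<epsilon> > 0" "\<forall>y\<in>tm_space X. tm_dist X x y < \<epsilon> \<longrightarrow> y \<in> V"
      unfolding metric_open_in_def by blast
    with V show "\<exists>\<epsilon>>0. \<forall>y\<in>topspace ?T. tm_dist X x y < \<epsilon> \<longrightarrow> y \<in> U"
      by (intro exI[of _ \<epsilon>]) simp
  qed
qed

lemma compact_topometric_subspace:
  assumes "compact_topometric_space X" "closedin (tm_top X) S"
  shows "compact_topometric_space (tm_subspace X S)"
  using assms closedin_compact_space[of "tm_top X" S]
  by (auto simp: compact_topometric_space_def topometric_subspace intro!: compact_space_subtopology)

section \<open>Evaluation\<close>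

text \<open>The restricted abstraction makes the value a point of the cube. The map is used both for
  a completely regular \<open>X\<close>, to build the compactification, and for a compact
  \<open>Y\<close>, to realise \<open>Y\<close> as a closed subset of a cube.\<close>

definition eval_tm :: "'a topometric \<Rightarrow> 'a \<Rightarrow> ('a \<Rightarrow> ennreal) \<Rightarrow> ennreal"
  where "eval_tm X x = (\<lambda>h\<in>C_L1 X ennreal_tm. h x)"

lemma eval_tm_C_L1: "restrict (eval_tm X) (tm_space X) \<in> C_L1 X (cube_tm (C_L1 X ennreal_tm))"
proof (rule C_L1_restrict)
  show "continuous_map (tm_top X) (tm_top (cube_tm (C_L1 X ennreal_tm))) (eval_tm X)"
    using C_L1_continuous[of _ X ennreal_tm]
    by (auto simp: cube_tm_top continuous_map_componentwise eval_tm_def)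
  show "tm_dist (cube_tm (C_L1 X ennreal_tm)) (eval_tm X x) (eval_tm X y) \<le> tm_dist X x y"
    if "x \<in> tm_space X" "y \<in> tm_space X" for x y
    using that by (auto simp: cube_tm_dist eval_tm_def C_L1_dist_le intro!: SUP_least)
qed

lemma eval_tm_continuous: "continuous_map (tm_top X) (tm_top (cube_tm (C_L1 X ennreal_tm))) (eval_tm X)"
  by (rule continuous_map_eq[OF C_L1_continuous[OF eval_tm_C_L1[of X]]]) simp

text \<open>The other inequality is automatic, since all coordinates are 1-Lipschitz. What remains
  is that such functions recover the distance, which is shown separately for compact and for
  completely regular spaces.\<close>

lemma eval_tm_isometric_iff:
  "isometric_on X (cube_tm (C_L1 X ennreal_tm)) (eval_tm X) \<longleftrightarrow>
    (\<forall>x\<in>tm_space X. \<forall>y\<in>tm_space X.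
      tm_dist X x y \<le> (SUP h\<in>C_L1 X ennreal_tm. tm_dist ennreal_tm (h x) (h y)))"
proof -
  have "tm_dist (cube_tm (C_L1 X ennreal_tm)) (eval_tm X x) (eval_tm X y) =
      (SUP h\<in>C_L1 X ennreal_tm. tm_dist ennreal_tm (h x) (h y))" for x y
    by (simp add: cube_tm_dist eval_tm_def)
  moreover have "(SUP h\<in>C_L1 X ennreal_tm. tm_dist ennreal_tm (h x) (h y)) \<le> tm_dist X x y"
    if "x \<in> tm_space X" "y \<in> tm_space X" for x y
    using that by (auto simp: C_L1_dist_le intro!: SUP_least)
  ultimately show ?thesis
    unfolding isometric_on_def by (auto intro!: antisym)
qed

lemma isometric_inj_on:
  assumes "topometric_space X" "topometric_space Y" "isometric_on X Y f" "f ` tm_space X \<subseteq> tm_space Y"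
  shows "inj_on f (tm_space X)"
proof (rule inj_onI)
  fix x y assume xy: "x \<in> tm_space X" "y \<in> tm_space X" "f x = f y"
  then have "f x \<in> tm_space Y" using assms(4) by blast
  then have "tm_dist Y (f x) (f y) = 0"
    using topometric_dist_eq_0[OF assms(2)] xy by simp
  moreover have "tm_dist Y (f x) (f y) = tm_dist X x y"
    using assms(3) xy(1,2) unfolding isometric_on_def by blast
  ultimately show "x = y"
    using topometric_dist_eq_0[OF assms(1) xy(1,2)] by simp
qed

section \<open>Urysohn's lemma for compact topometric spaces\<close>

definition thickening :: "'a topometric \<Rightarrow> 'a set \<Rightarrow> ennreal \<Rightarrow> 'a set"
  where "thickening Y A r = {y \<in> tm_space Y. \<exists>a\<in>A. tm_dist Y a y \<le> r}"

text \<open>The thickening is the second projection of the closed set of pairs at distance at most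
  \<open>r\<close> with first entry in \<open>A\<close>, and projecting along a compact factor is a
  closed map.\<close>

lemma closedin_thickening:
  assumes Y: "compact_topometric_space Y" and A: "closedin (tm_top Y) A"
  shows "closedin (tm_top Y) (thickening Y A r)"
proof -
  let ?P = "prod_topology (tm_top Y) (tm_top Y)"
  let ?D = "{p \<in> tm_space Y \<times> tm_space Y. tm_dist Y (fst p) (snd p) \<le> r} \<inter> A \<times> tm_space Y"
  have "closedin ?P (A \<times> tm_space Y)"
    using A by (simp add: closedin_prod_Times_iff)
  then have "closedin ?P ?D"
    using topometric_closedin_dist_le[of Y r] Y
    by (auto simp: compact_topometric_space_def intro!: closedin_Int)
  moreover have "closed_map ?P (tm_top Y) snd"
    using Y by (simp add: closed_map_snd compact_topometric_space_def)
  ultimately have "closedin (tm_top Y) (snd ` ?D)"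
    by (simp add: closed_map_def)
  moreover have "snd ` ?D = thickening Y A r"
    using closedin_subset[OF A] by (force simp: thickening_def image_iff)
  ultimately show ?thesis by simp
qed

lemma subset_thickening:
  assumes "topometric_space Y" "A \<subseteq> tm_space Y"
  shows "A \<subseteq> thickening Y A r"
proof
  fix a assume a: "a \<in> A"
  then have "tm_dist Y a a = 0" using assms topometric_dist_eq_0[of Y a a] by blast
  with a assms show "a \<in> thickening Y A r" by (force simp: thickening_def)
qed

text \<open>
  A level \<open>(t, K, U)\<close> stands for the requirement
  \<open>{g < t} \<subseteq> U \<subseteq> K \<subseteq> {g \<le> t}\<close> on the 1-Lipschitz function \<open>g\<close> to be built, which
  forces the condition below on any two levels.
\<close>

fun level_below :: "'a topometric \<Rightarrow> rat \<times> 'a set \<times> 'a set \<Rightarrow> rat \<times> 'a set \<times> 'a set \<Rightarrow> bool"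
  where "level_below Y (s, K, U) (t, L, V) \<longleftrightarrow>
    (s < t \<longrightarrow> thickening Y K (ennreal (of_rat (t - s))) \<subseteq> V)"

text \<open>The levels below \<open>s\<close> force a closed set \<open>C\<close> into the new
  \<open>U\<close>, and those above force the new \<open>K\<close> to avoid a closed set
  \<open>D\<close>; finiteness keeps both unions closed. Compatibility of the old levels makes
  \<open>C\<close> and \<open>D\<close> disjoint, and normality separates them.\<close>

lemma insert_level:
  assumes Y: "compact_topometric_space Y" and "finite \<L>"
    and closed: "\<And>t K U. (t, K, U) \<in> \<L> \<Longrightarrow> closedin (tm_top Y) K"
    and "open": "\<And>t K U. (t, K, U) \<in> \<L> \<Longrightarrow> openin (tm_top Y) U"
    and below: "\<And>l m. l \<in> \<L> \<Longrightarrow> m \<in> \<L> \<Longrightarrow> level_below Y l m"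
  shows "\<exists>K U. closedin (tm_top Y) K \<and> openin (tm_top Y) U \<and> U \<subseteq> K \<and>
    (\<forall>l\<in>\<L>. level_below Y l (s, K, U) \<and> level_below Y (s, K, U) l)"
proof -
  have top: "topometric_space Y" and comp: "compact_space (tm_top Y)"
    using Y by (auto simp: compact_topometric_space_def)
  define C where "C = (\<Union>(t, K, U)\<in>{l \<in> \<L>. fst l < s}. thickening Y K (ennreal (of_rat (s - t))))"
  \<comment> \<open>By symmetry of the distance, a thickening of \<open>K\<close> stays inside an
    open set when \<open>K\<close> avoids the thickening of its complement by the same
    radius.\<close>
  define D where "D = (\<Union>(t, K, U)\<in>{l \<in> \<L>. s < fst l}. thickening Y (tm_space Y - U) (ennreal (of_rat (t - s))))"
  have compl: "closedin (tm_top Y) (tm_space Y - U)" if "(t, K, U) \<in> \<L>" for t K U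
    using "open"[OF that] by blast
  have "closedin (tm_top Y) C"
    unfolding C_def using \<open>finite \<L>\<close> closed closedin_thickening[OF Y]
    by (intro closedin_Union) auto
  moreover have "closedin (tm_top Y) D"
    unfolding D_def using \<open>finite \<L>\<close> compl closedin_thickening[OF Y]
    by (intro closedin_Union) auto
  moreover have "disjnt C D"
    unfolding disjnt_iff
  proof (intro allI notI, elim conjE)
    fix w assume "w \<in> C" "w \<in> D"
    then obtain t K U t' K' U' a b where *:
      "(t, K, U) \<in> \<L>" "t < s" "a \<in> K" "tm_dist Y a w \<le> ennreal (of_rat (s - t))"
      "(t', K', U') \<in> \<L>" "s < t'" "b \<in> tm_space Y" "b \<notin> U'" "tm_dist Y b w \<le> ennreal (of_rat (t' - s))"
      "w \<in> tm_space Y"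
      by (auto simp: C_def D_def thickening_def)
    have a: "a \<in> tm_space Y" using closed[OF *(1)] *(3) closedin_subset by blast
    \<comment> \<open>Through \<open>w\<close> the two radii add up to \<open>t' - t\<close>, so
      \<open>b\<close> lies in the thickening of \<open>K\<close> that the old levels keep inside
      \<open>U'\<close>.\<close>
    have "tm_dist Y a b \<le> tm_dist Y a w + tm_dist Y b w"
      using topometric_dist_triangle[OF top a *(10,7)] topometric_dist_sym[OF top *(10,7)] by simp
    also have "\<dots> \<le> ennreal (of_rat (s - t)) + ennreal (of_rat (t' - s))"
      using * by (intro add_mono)
    also have "\<dots> = ennreal (of_rat (t' - t))"
      using *(2,6) by (simp add: of_rat_diff less_imp_le of_rat_less of_rat_less_eq flip: ennreal_plus)
    finally have "b \<in> thickening Y K (ennreal (of_rat (t' - t)))"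
      using * by (auto simp: thickening_def)
    moreover have "t < t'" using * by simp
    ultimately have "b \<in> U'"
      using below[OF *(1,5)] by auto
    with * show False by blast
  qed
  moreover have "normal_space (tm_top Y)"
    using comp topometric_Hausdorff[OF top] compact_Hausdorff_or_regular_imp_normal_space by blast
  ultimately obtain U where U: "openin (tm_top Y) U" "C \<subseteq> U" "disjnt D (tm_top Y closure_of U)"
    unfolding normal_space by blast
  let ?K = "tm_top Y closure_of U"
  have "level_below Y l (s, ?K, U) \<and> level_below Y (s, ?K, U) l" if "l \<in> \<L>" for l
  proof -
    obtain t K V where l: "l = (t, K, V)" by (cases l)
    have "thickening Y K (ennreal (of_rat (s - t))) \<subseteq> U" if "t < s"
      using that U(2) \<open>l \<in> \<L>\<close> l unfolding C_def by fastforce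
    moreover have "thickening Y ?K (ennreal (of_rat (t - s))) \<subseteq> V" if "s < t"
    proof
      fix w assume w: "w \<in> thickening Y ?K (ennreal (of_rat (t - s)))"
      then obtain a where a: "a \<in> ?K" "tm_dist Y a w \<le> ennreal (of_rat (t - s))" "w \<in> tm_space Y"
        by (auto simp: thickening_def)
      have aY: "a \<in> tm_space Y" using a(1) closure_of_subset_topspace by fast
      show "w \<in> V"
      proof (rule ccontr)
        assume "w \<notin> V"
        then have "a \<in> thickening Y (tm_space Y - V) (ennreal (of_rat (t - s)))"
          using a aY topometric_dist_sym[OF top aY a(3)] by (auto simp: thickening_def)
        then have "a \<in> D"
          using that \<open>l \<in> \<L>\<close> l unfolding D_def by force
        with a U(3) show False by (auto simp: disjnt_iff)
      qed
    qed
    ultimately show ?thesis by (simp add: l)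
  qed
  moreover have "U \<subseteq> ?K" using U(1) by (simp add: closure_of_subset openin_subset)
  ultimately show ?thesis using U(1) closedin_closure_of by blast
qed

text \<open>Levels are chosen for the rationals one at a time in the order of \<open>to_nat\<close>,
  each by \<open>insert_level\<close> against the finitely many earlier ones and two initial levels
  that carry the boundary conditions at \<open>x\<close> and \<open>y\<close>.\<close>

lemma ex_levels:
  fixes r :: rat
  assumes Y: "compact_topometric_space Y" and x: "x \<in> tm_space Y" and y: "y \<in> tm_space Y"
    and "0 \<le> r" and r: "ennreal (of_rat r) < tm_dist Y x y"
  shows "\<exists>K U. (\<forall>q. closedin (tm_top Y) (K q) \<and> openin (tm_top Y) (U q) \<and> U q \<subseteq> K q) \<and>
    (\<forall>p q. p < q \<longrightarrow> thickening Y (K p) (ennreal (of_rat (q - p))) \<subseteq> U q) \<and>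
    (\<forall>q>0. x \<in> U q) \<and> (\<forall>q<r. y \<notin> K q)"
proof -
  have top: "topometric_space Y" using Y by (simp add: compact_topometric_space_def)
  \<comment> \<open>In terms of the function \<open>g\<close> to be built, \<open>?x\<close> encodes
    \<open>g x \<le> 0\<close> and \<open>0 \<le> g\<close>, its empty open part forcing the levels
    at negative rationals to be empty; \<open>?y\<close> encodes \<open>g \<le> r\<close> and
    \<open>r \<le> g y\<close>. Later levels at 0 and \<open>r\<close> do not conflict, as only
    strictly ordered levels are compared.\<close>
  let ?x = "(0, {x}, {})" and ?y = "(r, tm_space Y, tm_space Y - {y})"
  define \<L> where "\<L> f q = {?x, ?y} \<union> (\<lambda>p. (p, f p)) ` {p. to_nat p < to_nat q}"
    for f :: "rat \<Rightarrow> 'a set \<times> 'a set" and q :: rat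
  define P where "P f q v \<longleftrightarrow> closedin (tm_top Y) (fst v) \<and> openin (tm_top Y) (snd v) \<and>
      snd v \<subseteq> fst v \<and> (\<forall>l\<in>\<L> f q. level_below Y l (q, v) \<and> level_below Y (q, v) l)"
    for f :: "rat \<Rightarrow> 'a set \<times> 'a set" and q :: rat and v
  have xy: "closedin (tm_top Y) {x}" "openin (tm_top Y) (tm_space Y - {y})"
    using x y topometric_Hausdorff[OF top] by (auto simp: closedin_Hausdorff_sing_eq)
  \<comment> \<open>This is where \<open>r < d(x, y)\<close> enters: \<open>y\<close> lies outside
    the closed \<open>r\<close>-neighbourhood of \<open>x\<close>.\<close>
  have xy_below: "level_below Y ?x ?y"
    using r by (auto simp: thickening_def)
  \<comment> \<open>Dependent choice along the well-founded order of the codes: \<open>P f q\<close>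
    looks only at values of \<open>f\<close> at rationals enumerated before
    \<open>q\<close>.\<close>
  have "\<exists>f. \<forall>q. P f q (f q)"
  proof (rule dependent_wf_choice[of "inv_image less_than (to_nat :: rat \<Rightarrow> nat)"])
    fix f g :: "rat \<Rightarrow> 'a set \<times> 'a set" and q v
    assume "\<And>p. (p, q) \<in> inv_image less_than to_nat \<Longrightarrow> f p = g p"
    then have "\<L> f q = \<L> g q" unfolding \<L>_def by (auto simp: image_iff)
    then show "P f q v = P g q v" by (simp add: P_def)
  next
    fix q f
    assume "\<And>p. (p, q) \<in> inv_image less_than to_nat \<Longrightarrow> P f p (f p)"
    then have IH: "P f p (f p)" if "to_nat p < to_nat q" for p using that by simp
    have "finite {p :: rat. to_nat p < to_nat q}"
      using finite_vimageI[of "{..<to_nat q}" "to_nat :: rat \<Rightarrow> nat"] by (simp add: vimage_def)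
    then have "finite (\<L> f q)" by (simp add: \<L>_def)
    moreover have "closedin (tm_top Y) K \<and> openin (tm_top Y) U" if "(t, K, U) \<in> \<L> f q" for t K U
      using that xy IH unfolding \<L>_def P_def by auto (metis fst_conv snd_conv)+
    moreover have "level_below Y l m" if lm: "l \<in> \<L> f q" "m \<in> \<L> f q" for l m
    proof -
      have *: "level_below Y l (p, f p) \<and> level_below Y (p, f p) l" if "to_nat p < to_nat q" "l \<in> \<L> f p" for p l
        using IH[OF that(1)] that(2) unfolding P_def by blast
      \<comment> \<open>Of two chosen levels, the later one in the enumeration was chosen compatible
        with the earlier, in both directions.\<close>
      have **: "level_below Y (p, f p) (p', f p')" if "to_nat p < to_nat q" "to_nat p' < to_nat q" for p p'
      proof (cases "to_nat p" "to_nat p'" rule: linorder_cases)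
        case less
        then show ?thesis using *[OF that(2), of "(p, f p)"] by (simp add: \<L>_def)
      next
        case equal
        then show ?thesis by (cases "f p") simp
      next
        case greater
        then show ?thesis using *[OF that(1), of "(p', f p')"] by (simp add: \<L>_def)
      qed
      have xL: "?x \<in> \<L> f p" "?y \<in> \<L> f p" for p
        by (simp_all add: \<L>_def)
      have "level_below Y ?x ?x" "level_below Y ?y ?y" "level_below Y ?y ?x"
        using \<open>0 \<le> r\<close> by auto
      with xy_below lm * ** xL show ?thesis
        unfolding \<L>_def[of f q] by blast
    qed
    ultimately have "\<exists>K U. closedin (tm_top Y) K \<and> openin (tm_top Y) U \<and> U \<subseteq> K \<and>
        (\<forall>l\<in>\<L> f q. level_below Y l (q, K, U) \<and> level_below Y (q, K, U) l)"
      by (intro insert_level[OF Y]) auto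
    then show "\<exists>v. P f q v" unfolding P_def by auto
  qed (simp add: wf_inv_image)
  then obtain f where f: "\<And>q. P f q (f q)" by blast
  show ?thesis
  proof (rule exI[of _ "fst \<circ> f"], rule exI[of _ "snd \<circ> f"], intro conjI allI impI)
    fix q
    have P: "P f q (f q)" by (rule f)
    then show "closedin (tm_top Y) ((fst \<circ> f) q)" "openin (tm_top Y) ((snd \<circ> f) q)"
        "(snd \<circ> f) q \<subseteq> (fst \<circ> f) q"
      by (simp_all add: P_def)
    have "level_below Y ?x (q, f q)" "level_below Y (q, f q) ?y"
      using P by (simp_all add: P_def \<L>_def)
    then have xU: "0 < q \<longrightarrow> thickening Y {x} (ennreal (of_rat q)) \<subseteq> snd (f q)"
      and yK: "q < r \<longrightarrow> thickening Y (fst (f q)) (ennreal (of_rat (r - q))) \<subseteq> tm_space Y - {y}"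
      by (cases "f q"; simp)+
    show "x \<in> (snd \<circ> f) q" if "0 < q"
      using that xU subset_thickening[OF top, of "{x}"] x by auto
    show "y \<notin> (fst \<circ> f) q" if "q < r"
      using that yK subset_thickening[OF top, of "fst (f q)"] P closedin_subset unfolding P_def by fastforce
    show "thickening Y ((fst \<circ> f) p) (ennreal (of_rat (q - p))) \<subseteq> (snd \<circ> f) q" if "p < q" for p
    proof -
      have "level_below Y (p, f p) (q, f q)"
      proof (cases "to_nat p" "to_nat q" rule: linorder_cases)
        case less
        then show ?thesis using f[of q] by (simp add: P_def \<L>_def)
      next
        case equal
        then show ?thesis using that by simp
      next
        case greater
        then show ?thesis using f[of p] by (simp add: P_def \<L>_def)
      qed
      then show ?thesis using that by (cases "f p"; cases "f q") simp
    qed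
qed
qed

lemma ennreal_rat_dense:
  assumes "a < b"
  shows "\<exists>q>0. a < ennreal (of_rat q) \<and> ennreal (of_rat q) < b"
proof -
  have real: "\<exists>c\<ge>0. a < ennreal c \<and> ennreal c < b" if "a < b" for a b
  proof -
    obtain d where d: "a < d" "d < b" using dense \<open>a < b\<close> by blast
    then obtain c where "0 \<le> c" "d = ennreal c" by (cases d) auto
    with d show ?thesis by blast
  qed
  obtain c where c: "0 \<le> c" "a < ennreal c" "ennreal c < b" using real[OF assms] by blast
  obtain c' where c': "0 \<le> c'" "ennreal c < ennreal c'" "ennreal c' < b" using real[OF c(3)] by blast
  then obtain q where q: "c < of_rat q" "of_rat q < c'"
    using c(1) of_rat_dense[of c c'] by (auto simp: ennreal_less_iff)
  have "0 < q" using order.strict_trans1[OF c(1) q(1)] by simp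
  moreover have "a < ennreal (of_rat q)"
    using c(2) ennreal_leI[OF less_imp_le[OF q(1)]] by (rule order.strict_trans2)
  moreover have "ennreal (of_rat q) < b"
    using ennreal_leI[OF less_imp_le[OF q(2)]] c'(3) by (rule order.strict_trans1)
  ultimately show ?thesis by blast
qed

text \<open>As in Urysohn's lemma, \<open>g z\<close> is the infimum of the levels containing
  \<open>z\<close>. Nesting of the levels gives continuity, and the thickening condition gives the
  Lipschitz bound.\<close>

lemma ex_C_L1_separating:
  fixes r :: rat
  assumes Y: "compact_topometric_space Y" and x: "x \<in> tm_space Y" and y: "y \<in> tm_space Y"
    and "0 \<le> r" and r: "ennreal (of_rat r) < tm_dist Y x y"
  shows "\<exists>g\<in>C_L1 Y ennreal_tm. g x = 0 \<and> ennreal (of_rat r) \<le> g y"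
proof -
  have top: "topometric_space Y" using Y by (simp add: compact_topometric_space_def)
  obtain K U where K: "\<And>q. closedin (tm_top Y) (K q)" and U: "\<And>q. openin (tm_top Y) (U q)"
    and UK: "\<And>q. U q \<subseteq> K q"
    and thick: "\<And>p q. p < q \<Longrightarrow> thickening Y (K p) (ennreal (of_rat (q - p))) \<subseteq> U q"
    and xU: "\<And>q. 0 < q \<Longrightarrow> x \<in> U q" and yK: "\<And>q. q < r \<Longrightarrow> y \<notin> K q"
    using ex_levels[OF assms] by metis
  have KU: "K p \<subseteq> U q" if "p < q" for p q
    using thick[OF that] subset_thickening[OF top closedin_subset[OF K]] by blast
  \<comment> \<open>Only positive rationals enter, because \<open>ennreal\<close> sends negative
    numbers to 0. The infimum of the empty set is \<open>\<infinity>\<close>.\<close>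
  define g where "g z = (INF q\<in>{q. 0 < q \<and> z \<in> U q}. ennreal (of_rat q))" for z
  have g_less: "g z < a \<longleftrightarrow> (\<exists>q>0. z \<in> U q \<and> ennreal (of_rat q) < a)" for z a
    by (auto simp: g_def INF_less_iff)
  \<comment> \<open>Membership in the closed set \<open>K p\<close> already bounds
    \<open>g z\<close> by \<open>p\<close>, since \<open>K p\<close> lies in \<open>U q\<close> for
    \<open>q\<close> slightly above \<open>p\<close>.\<close>
  have g_less_K: "\<exists>q>0. z \<in> U q \<and> ennreal (of_rat q) < a" if p: "0 < p" "z \<in> K p" "ennreal (of_rat p) < a" for z a p
  proof -
    obtain q where "0 < q" "ennreal (of_rat p) < ennreal (of_rat q)" "ennreal (of_rat q) < a"
      using ennreal_rat_dense[OF p(3)] by blast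
    then show ?thesis using KU[of p q] p by (auto simp: ennreal_less_iff of_rat_less intro!: exI[of _ q])
  qed
  have "continuous_map (tm_top Y) euclidean g"
  proof (rule continuous_map_into_order_topology)
    fix a
    have "{z \<in> tm_space Y. g z < a} = (\<Union>q\<in>{q. 0 < q \<and> ennreal (of_rat q) < a}. U q)"
      using openin_subset[OF U] by (auto simp: g_less)
    then show "openin (tm_top Y) {z \<in> tm_space Y. g z < a}"
      using U by auto
    have "{z \<in> tm_space Y. a < g z} = (\<Union>q\<in>{q. 0 < q \<and> a < ennreal (of_rat q)}. tm_space Y - K q)"
    proof (intro equalityI subsetI)
      fix z assume z: "z \<in> {z \<in> tm_space Y. a < g z}"
      then obtain q where q: "0 < q" "a < ennreal (of_rat q)" "ennreal (of_rat q) < g z"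
        using ennreal_rat_dense by blast
      then have "z \<notin> K q"
        using g_less_K[of q z "g z"] g_less[of z "g z"] by blast
      with q z show "z \<in> (\<Union>q\<in>{q. 0 < q \<and> a < ennreal (of_rat q)}. tm_space Y - K q)" by blast
    next
      fix z assume "z \<in> (\<Union>q\<in>{q. 0 < q \<and> a < ennreal (of_rat q)}. tm_space Y - K q)"
      then obtain q where q: "0 < q" "a < ennreal (of_rat q)" "z \<in> tm_space Y" "z \<notin> K q" by blast
      have "\<not> g z < ennreal (of_rat q)"
      proof
        assume "g z < ennreal (of_rat q)"
        then obtain p where "0 < p" "z \<in> U p" "ennreal (of_rat p) < ennreal (of_rat q)"
          unfolding g_less by blast
        then show False using q KU[of p q] UK by (auto simp: ennreal_less_iff of_rat_less)
      qed
      with q show "z \<in> {z \<in> tm_space Y. a < g z}" by auto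
    qed
    moreover have "openin (tm_top Y) (tm_space Y - K q)" for q
      using K by blast
    ultimately show "openin (tm_top Y) {z \<in> tm_space Y. a < g z}"
      by (metis (no_types, lifting) openin_Union imageE)
  qed
  \<comment> \<open>If \<open>z\<close> is in \<open>U q\<close> and the distance is a real
    \<open>c\<close>, any rational \<open>p > q + c\<close> puts \<open>w\<close> in the thickening
    of \<open>K q\<close> by \<open>p - q\<close>, hence in \<open>U p\<close>. At infinite distance
    there is nothing to show.\<close>
  moreover have lip: "g w \<le> g z + tm_dist Y z w" if zw: "z \<in> tm_space Y" "w \<in> tm_space Y" for z w
  proof (rule dense_ge)
    fix a assume a: "g z + tm_dist Y z w < a"
    show "g w \<le> a"
    proof (cases "tm_dist Y z w")
      case (real c)
      then have "g z < a - ennreal c"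
        using a by (simp add: less_diff_eq_ennreal ennreal_neq_top)
      then obtain q where q: "0 < q" "z \<in> U q" "ennreal (of_rat q) < a - ennreal c"
        unfolding g_less by blast
      then have "ennreal (of_rat q) + ennreal c < a"
        by (simp add: less_diff_eq_ennreal)
      then obtain p where p: "0 < p" "ennreal (of_rat q) + ennreal c < ennreal (of_rat p)" "ennreal (of_rat p) < a"
        using ennreal_rat_dense by blast
      have *: "of_rat q + c < of_rat p"
        using p(2) real q(1) by (simp add: ennreal_less_iff flip: ennreal_plus)
      then have "q < p" using real(1) by (simp add: of_rat_less[where 'a = real, symmetric])
      have "w \<in> thickening Y (K q) (ennreal (of_rat (p - q)))"
        using zw UK q real * by (auto simp: thickening_def of_rat_diff intro!: bexI[of _ z] ennreal_leI)
      then have "w \<in> U p" using thick[OF \<open>q < p\<close>] by blast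
      then have "g w < a" using g_less p by blast
      then show ?thesis by simp
    next
      case top
      then show ?thesis using a by simp
    qed
  qed
  moreover have "tm_dist ennreal_tm (g z) (g w) \<le> tm_dist Y z w" if "z \<in> tm_space Y" "w \<in> tm_space Y" for z w
    using lip[OF that] lip[OF that(2,1)] topometric_dist_sym[OF top that] by (simp add: ennreal_tm_dist_le_iff)
  ultimately have "restrict g (tm_space Y) \<in> C_L1 Y ennreal_tm"
    by (intro C_L1_restrict) simp_all
  moreover have "g x = 0"
  proof (rule ccontr)
    assume "g x \<noteq> 0"
    then obtain q where "0 < q" "ennreal (of_rat q) < g x" using ennreal_rat_dense[of 0 "g x"] by (auto simp: zero_less_iff_neq_zero)
    then show False using xU g_less[of x "g x"] by blast
  qed
  moreover have "ennreal (of_rat r) \<le> g y"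
  proof (rule ccontr)
    assume "\<not> ?thesis"
    then have "g y < ennreal (of_rat r)" by simp
    then obtain q where "0 < q" "y \<in> U q" "ennreal (of_rat q) < ennreal (of_rat r)"
      unfolding g_less by blast
    then show False using yK[of q] UK by (auto simp: ennreal_less_iff of_rat_less)
  qed
  ultimately show ?thesis using x y by (intro bexI[of _ "restrict g (tm_space Y)"]) auto
qed

text \<open>Every rational strictly below \<open>d(x, y)\<close> is attained or exceeded by the
  distance of two values of a separating function, and such rationals approach
  \<open>d(x, y)\<close>.\<close>

lemma compact_topometric_eval_isometric:
  assumes Y: "compact_topometric_space Y"
  shows "isometric_on Y (cube_tm (C_L1 Y ennreal_tm)) (eval_tm Y)"
  unfolding eval_tm_isometric_iff
proof (intro ballI)
  fix x y assume xy: "x \<in> tm_space Y" "y \<in> tm_space Y"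
  show "tm_dist Y x y \<le> (SUP h\<in>C_L1 Y ennreal_tm. tm_dist ennreal_tm (h x) (h y))"
  proof (rule dense_le)
    fix a assume a: "a < tm_dist Y x y"
    obtain q where q: "0 < q" "a < ennreal (of_rat q)" "ennreal (of_rat q) < tm_dist Y x y"
      using ennreal_rat_dense[OF a] by blast
    then obtain g where g: "g \<in> C_L1 Y ennreal_tm" "g x = 0" "ennreal (of_rat q) \<le> g y"
      using ex_C_L1_separating[OF Y xy, of q] by auto
    have "a \<le> ennreal (of_rat q)" using q by simp
    also have "\<dots> \<le> tm_dist ennreal_tm (g x) (g y)"
      using g ennreal_tm_dist_le_add[of "g y" "g x"] by (simp add: ennreal_tm_dist_sym)
    also have "\<dots> \<le> (SUP h\<in>C_L1 Y ennreal_tm. tm_dist ennreal_tm (h x) (h y))"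
      using g(1) by (rule SUP_upper)
    finally show "a \<le> (SUP h\<in>C_L1 Y ennreal_tm. tm_dist ennreal_tm (h x) (h y))" .
  qed
qed

section \<open>The compactification\<close>

text \<open>A continuous map from a compact space to a Hausdorff space is closed, and an isometric
  one is injective.\<close>

lemma compact_topometric_eval_embedding:
  assumes Y: "compact_topometric_space Y"
  shows "embedding_map (tm_top Y) (tm_top (cube_tm (C_L1 Y ennreal_tm))) (eval_tm Y)"
    and "closedin (tm_top (cube_tm (C_L1 Y ennreal_tm))) (eval_tm Y ` tm_space Y)"
proof -
  let ?C = "cube_tm (C_L1 Y ennreal_tm)"
  have C: "topometric_space ?C"
    using compact_topometric_cube by (auto simp: compact_topometric_space_def)
  have top: "topometric_space Y" and comp: "compact_space (tm_top Y)"
    using Y by (auto simp: compact_topometric_space_def)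
  have closed: "closed_map (tm_top Y) (tm_top ?C) (eval_tm Y)"
    using eval_tm_continuous comp topometric_Hausdorff[OF C] by (rule continuous_imp_closed_map)
  then show "closedin (tm_top ?C) (eval_tm Y ` tm_space Y)"
    by (simp add: closed_map_def)
  have "inj_on (eval_tm Y) (tm_space Y)"
    by (rule isometric_inj_on[OF top C compact_topometric_eval_isometric[OF Y]
          continuous_map_image_subset_topspace[OF eval_tm_continuous]])
  then show "embedding_map (tm_top Y) (tm_top ?C) (eval_tm Y)"
    by (rule injective_closed_imp_embedding_map[OF eval_tm_continuous closed])
qed

section \<open>Extension of maps into compact spaces\<close>

text \<open>With \<open>Y\<close> viewed inside its cube, each coordinate of \<open>f\<close>
  extends by the property for the half-line. The extensions combine to a map \<open>H\<close> whose
  values stay in the closed image of \<open>Y\<close>, and the inverse of evaluation, an isometry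
  there, brings it back to \<open>Y\<close>.\<close>

lemma unique_extension_compact:
  assumes B: "tm_compactification X B e" and ext: "unique_extension_property X B e ennreal_tm"
    and Y: "compact_topometric_space Y"
  shows "unique_extension_property X B e Y"
  unfolding unique_extension_property_def
proof
  fix f assume f: "f \<in> C_L1 X Y"
  have top: "topometric_space Y" using Y by (simp add: compact_topometric_space_def)
  have dense: "tm_top B closure_of (e ` tm_space X) = tm_space B"
    using B by (simp add: tm_compactification_def)
  have eB: "e x \<in> tm_space B" if "x \<in> tm_space X" for x
    using that B C_L1_mem[OF tm_embedding_C_L1, of X B e x] by (simp add: tm_compactification_def)
  define F where "F = C_L1 Y ennreal_tm"
  let ?C = "cube_tm F" and ?T = "eval_tm Y ` tm_space Y"
  have "\<forall>h\<in>F. \<exists>g. g \<in> C_L1 B ennreal_tm \<and> (\<forall>x\<in>tm_space X. g (e x) = h (f x))"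
  proof
    fix h assume "h \<in> F"
    then have "compose (tm_space X) h f \<in> C_L1 X ennreal_tm"
      using C_L1_compose f by (auto simp: F_def)
    then obtain g where "g \<in> C_L1 B ennreal_tm" "\<forall>x\<in>tm_space X. g (e x) = compose (tm_space X) h f x"
      using ext unfolding unique_extension_property_def by blast
    then show "\<exists>g. g \<in> C_L1 B ennreal_tm \<and> (\<forall>x\<in>tm_space X. g (e x) = h (f x))"
      by (auto simp: compose_eq)
  qed
  then obtain G where G: "\<And>h. h \<in> F \<Longrightarrow> G h \<in> C_L1 B ennreal_tm"
    and Ge: "\<And>h x. h \<in> F \<Longrightarrow> x \<in> tm_space X \<Longrightarrow> G h (e x) = h (f x)"
    by metis
  define H where "H b = (\<lambda>h\<in>F. G h b)" for b
  have H_cont: "continuous_map (tm_top B) (tm_top ?C) H"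
    using C_L1_continuous[OF G] by (auto simp: cube_tm_top continuous_map_componentwise H_def)
  have H_lip: "tm_dist ?C (H b) (H b') \<le> tm_dist B b b'" if "b \<in> tm_space B" "b' \<in> tm_space B" for b b'
    unfolding cube_tm_dist using that G by (intro SUP_least) (simp add: H_def C_L1_dist_le)
  have He: "H (e x) = eval_tm Y (f x)" if "x \<in> tm_space X" for x
    using that Ge by (auto simp: H_def eval_tm_def F_def)
  have T_closed: "closedin (tm_top ?C) ?T" and emb: "embedding_map (tm_top Y) (tm_top ?C) (eval_tm Y)"
    using compact_topometric_eval_embedding[OF Y] by (auto simp: F_def)
  \<comment> \<open>The points sent into \<open>?T\<close> form a closed set containing the dense
    image of \<open>X\<close>.\<close>
  have HT: "H b \<in> ?T" if "b \<in> tm_space B" for b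
  proof (rule forall_in_closure_of[of b "tm_top B" "e ` tm_space X"])
    show "b \<in> tm_top B closure_of e ` tm_space X" using that dense by simp
    show "H b \<in> ?T" if "b \<in> e ` tm_space X" for b
      using that He C_L1_mem[OF f] by auto
    show "closedin (tm_top B) {b \<in> tm_space B. H b \<in> ?T}"
      using H_cont T_closed by (rule closedin_continuous_map_preimage)
  qed
  obtain k where k: "homeomorphic_maps (tm_top Y) (subtopology (tm_top ?C) ?T) (eval_tm Y) k"
    using emb unfolding embedding_map_def homeomorphic_map_maps by blast
  have k_cont: "continuous_map (subtopology (tm_top ?C) ?T) (tm_top Y) k"
    and k_eval: "\<And>y. y \<in> tm_space Y \<Longrightarrow> k (eval_tm Y y) = y"
    using k by (auto simp: homeomorphic_maps_def)
  define g where "g = restrict (k \<circ> H) (tm_space B)"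
  have "continuous_map (tm_top B) (subtopology (tm_top ?C) ?T) H"
    using H_cont HT by (auto simp: continuous_map_in_subtopology)
  then have "continuous_map (tm_top B) (tm_top Y) (k \<circ> H)"
    using k_cont by (rule continuous_map_compose)
  moreover have kH: "k (H b) \<in> tm_space Y" "eval_tm Y (k (H b)) = H b" if b: "b \<in> tm_space B" for b
  proof -
    obtain y where "y \<in> tm_space Y" "H b = eval_tm Y y" using HT[OF b] by blast
    then show "k (H b) \<in> tm_space Y" "eval_tm Y (k (H b)) = H b" using k_eval by simp_all
  qed
  have "tm_dist Y ((k \<circ> H) b) ((k \<circ> H) b') \<le> tm_dist B b b'"
    if b: "b \<in> tm_space B" "b' \<in> tm_space B" for b b'
  proof -
    have "tm_dist Y (k (H b)) (k (H b')) = tm_dist ?C (H b) (H b')"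
      using compact_topometric_eval_isometric[OF Y] kH(1)[OF b(1)] kH(1)[OF b(2)]
      unfolding F_def[symmetric] isometric_on_def by (metis kH(2) b)
    then show ?thesis using H_lip[OF b] by simp
  qed
  ultimately have "g \<in> C_L1 B Y"
    unfolding g_def by (rule C_L1_restrict)
  moreover have "\<forall>x\<in>tm_space X. g (e x) = f x"
    using eB He k_eval C_L1_mem[OF f] by (simp add: g_def)
  moreover have "g1 = g2" if "g1 \<in> C_L1 B Y \<and> (\<forall>x\<in>tm_space X. g1 (e x) = f x)"
      "g2 \<in> C_L1 B Y \<and> (\<forall>x\<in>tm_space X. g2 (e x) = f x)" for g1 g2
    using that by (intro C_L1_eq_on_dense[OF _ _ topometric_Hausdorff[OF top] dense]) auto
  ultimately show "\<exists>!g. g \<in> C_L1 B Y \<and> (\<forall>x\<in>tm_space X. g (e x) = f x)"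
    by blast
qed

section \<open>Uniqueness of the compactification\<close>

text \<open>The composition and the identity are both continuous 1-Lipschitz self-maps of
  \<open>B\<close> that agree on a dense set.\<close>

lemma C_L1_left_inverse:
  assumes \<phi>: "\<phi> \<in> C_L1 B B'" and \<psi>: "\<psi> \<in> C_L1 B' B" and B: "topometric_space B"
    and dense: "tm_top B closure_of (e ` S) = tm_space B" and eB: "\<And>x. x \<in> S \<Longrightarrow> e x \<in> tm_space B"
    and eq: "\<And>x. x \<in> S \<Longrightarrow> \<psi> (\<phi> (e x)) = e x" and b: "b \<in> tm_space B"
  shows "\<psi> (\<phi> b) = b"
proof -
  have "compose (tm_space B) \<psi> \<phi> = restrict id (tm_space B)"
  proof (rule C_L1_eq_on_dense[OF C_L1_compose[OF \<phi> \<psi>] _ topometric_Hausdorff[OF B] dense])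
    show "restrict id (tm_space B) \<in> C_L1 B B"
      by (rule C_L1_restrict) auto
    show "compose (tm_space B) \<psi> \<phi> b = restrict id (tm_space B) b" if "b \<in> e ` S" for b
      using that eB eq by (auto simp: compose_eq)
  qed
  from fun_cong[OF this, of b] show ?thesis using b by (simp add: compose_eq)
qed

text \<open>Both spaces are compact, so each embedding of \<open>X\<close> extends over the other
  compactification. The extensions are mutually inverse, and 1-Lipschitz maps inverse to each other
  are isometries. Any isomorphism fixing \<open>X\<close> is itself such an extension, hence
  unique.\<close>

lemma is_beta_unique_isomorphism:
  assumes B: "is_beta X B e" and B': "is_beta X B' e'"
  shows "\<exists>!\<phi>. \<phi> \<in> tm_isomorphisms B B' \<and> (\<forall>x\<in>tm_space X. \<phi> (e x) = e' x)"
proof -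
  have comp: "compact_topometric_space B" "compact_topometric_space B'"
    and emb: "restrict e (tm_space X) \<in> C_L1 X B" "restrict e' (tm_space X) \<in> C_L1 X B'"
    and dense: "tm_top B closure_of (e ` tm_space X) = tm_space B" "tm_top B' closure_of (e' ` tm_space X) = tm_space B'"
    using B B' tm_embedding_C_L1 by (auto simp: is_beta_def tm_compactification_def)
  have ext: "unique_extension_property X B e B'" "unique_extension_property X B' e' B"
    using B B' unique_extension_compact[where X = X and B = B and e = e, OF _ _ comp(2)]
      unique_extension_compact[where X = X and B = B' and e = e', OF _ _ comp(1)] by (simp_all add: is_beta_def)
  have ex1: "\<exists>!g. g \<in> C_L1 B B' \<and> (\<forall>x\<in>tm_space X. g (e x) = e' x)"
    using ext(1)[unfolded unique_extension_property_def, rule_format, OF emb(2)] by simp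
  then obtain \<phi> where \<phi>: "\<phi> \<in> C_L1 B B'" "\<forall>x\<in>tm_space X. \<phi> (e x) = e' x"
    by blast
  have "\<exists>!g. g \<in> C_L1 B' B \<and> (\<forall>x\<in>tm_space X. g (e' x) = e x)"
    using ext(2)[unfolded unique_extension_property_def, rule_format, OF emb(1)] by simp
  then obtain \<psi> where \<psi>: "\<psi> \<in> C_L1 B' B" "\<forall>x\<in>tm_space X. \<psi> (e' x) = e x"
    by blast
  have top: "topometric_space B" "topometric_space B'"
    using comp by (simp_all add: compact_topometric_space_def)
  have mem: "e x \<in> tm_space B" "e' x \<in> tm_space B'" if "x \<in> tm_space X" for x
    using C_L1_mem[OF emb(1) that] C_L1_mem[OF emb(2) that] that by simp_all
  have inv: "\<psi> (\<phi> b) = b" if "b \<in> tm_space B" for b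
    by (rule C_L1_left_inverse[OF \<phi>(1) \<psi>(1) top(1) dense(1)]) (use \<phi>(2) \<psi>(2) mem that in simp_all)
  have inv': "\<phi> (\<psi> b) = b" if "b \<in> tm_space B'" for b
    by (rule C_L1_left_inverse[OF \<psi>(1) \<phi>(1) top(2) dense(2)]) (use \<phi>(2) \<psi>(2) mem that in simp_all)
  have "homeomorphic_maps (tm_top B) (tm_top B') \<phi> \<psi>"
    using inv inv' C_L1_continuous[OF \<phi>(1)] C_L1_continuous[OF \<psi>(1)] by (simp add: homeomorphic_maps_def)
  moreover have "isometric_on B B' \<phi>"
    unfolding isometric_on_def
  proof (intro ballI antisym)
    fix b c assume b: "b \<in> tm_space B" "c \<in> tm_space B"
    show "tm_dist B' (\<phi> b) (\<phi> c) \<le> tm_dist B b c" using \<phi>(1) b by (rule C_L1_dist_le)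
    show "tm_dist B b c \<le> tm_dist B' (\<phi> b) (\<phi> c)"
      using C_L1_dist_le[OF \<psi>(1) C_L1_mem[OF \<phi>(1) b(1)] C_L1_mem[OF \<phi>(1) b(2)]] b inv by simp
  qed
  ultimately have "\<phi> \<in> tm_isomorphisms B B'"
    using \<phi>(1) homeomorphic_maps_map by (auto simp: tm_isomorphisms_def C_L1_iff)
  moreover have "\<phi>' \<in> C_L1 B B'" if "\<phi>' \<in> tm_isomorphisms B B'" for \<phi>'
    using that homeomorphic_imp_continuous_map by (auto simp: tm_isomorphisms_def C_L1_iff isometric_on_def)
  ultimately show ?thesis
    using \<phi> ex1 by blast
qed

section \<open>Existence of the compactification\<close>

text \<open>Passes from complex test functions to half-line ones by the reverse triangle inequality.
  Below, \<open>c\<close> is either \<open>f y\<close>, to preserve a distance, or the constant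
  value of \<open>f\<close> on a closed set.\<close>

lemma C_L1_cmod_diff:
  assumes "f \<in> C_L1 X complex_tm"
  shows "(\<lambda>z\<in>tm_space X. ennreal (cmod (f z - c))) \<in> C_L1 X ennreal_tm"
proof (rule C_L1_restrict)
  have f: "continuous_map (tm_top X) euclidean f"
    using C_L1_continuous[OF assms] by (simp add: complex_tm_def)
  have "continuous_on UNIV (\<lambda>w. ennreal (cmod (w - c)))"
    by (intro continuous_on_ennreal continuous_intros)
  then have "continuous_map euclidean euclidean (\<lambda>w. ennreal (cmod (w - c)))"
    by simp
  from continuous_map_compose[OF f this]
  show "continuous_map (tm_top X) (tm_top ennreal_tm) (\<lambda>z. ennreal (cmod (f z - c)))"
    by (simp add: o_def)
  fix x y assume xy: "x \<in> tm_space X" "y \<in> tm_space X"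
  have "tm_dist ennreal_tm (ennreal (cmod (f x - c))) (ennreal (cmod (f y - c))) =
      ennreal \<bar>cmod (f x - c) - cmod (f y - c)\<bar>"
    by (simp add: ennreal_tm_def)
  also have "\<dots> \<le> ennreal (cmod (f x - f y))"
    using norm_triangle_ineq3[of "f x - c" "f y - c"] by (intro ennreal_leI) simp
  also have "\<dots> \<le> tm_dist X x y"
    using C_L1_dist_le[OF assms xy] by (simp add: complex_tm_def)
  finally show "tm_dist ennreal_tm (ennreal (cmod (f x - c))) (ennreal (cmod (f y - c))) \<le> tm_dist X x y" .
qed

text \<open>The distance formula makes evaluation isometric. Separation of points from closed sets
  makes it closed onto its image: the image of a closed \<open>A\<close> is cut out by the zero sets
  of the coordinates that vanish on \<open>A\<close>.\<close>

lemma completely_regular_eval_embedding: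
  assumes X: "completely_regular_topometric X"
  shows "tm_embedding X (cube_tm (C_L1 X ennreal_tm)) (eval_tm X)"
proof -
  define F where "F = C_L1 X ennreal_tm"
  let ?C = "cube_tm F" and ?e = "eval_tm X"
  have top: "topometric_space X" and sep: "separates_points_from_closed_sets (tm_top X) (C_L1 X complex_tm)"
    and d: "\<And>x y. x \<in> tm_space X \<Longrightarrow> y \<in> tm_space X \<Longrightarrow>
      tm_dist X x y = (SUP f\<in>C_L1 X complex_tm. ennreal (cmod (f x - f y)))"
    using X by (auto simp: completely_regular_topometric_def)
  have e_cont: "continuous_map (tm_top X) (tm_top ?C) ?e"
    using eval_tm_continuous by (simp add: F_def)
  have iso: "isometric_on X ?C ?e"
    unfolding F_def eval_tm_isometric_iff
  proof (intro ballI)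
    fix x y assume xy: "x \<in> tm_space X" "y \<in> tm_space X"
    show "tm_dist X x y \<le> (SUP h\<in>C_L1 X ennreal_tm. tm_dist ennreal_tm (h x) (h y))"
      unfolding d[OF xy]
    proof (rule SUP_least)
      fix f assume f: "f \<in> C_L1 X complex_tm"
      let ?h = "\<lambda>z\<in>tm_space X. ennreal (cmod (f z - f y))"
      have "ennreal (cmod (f x - f y)) = tm_dist ennreal_tm (?h x) (?h y)"
        using xy by (simp add: ennreal_tm_def)
      also have "\<dots> \<le> (SUP h\<in>C_L1 X ennreal_tm. tm_dist ennreal_tm (h x) (h y))"
        using C_L1_cmod_diff[OF f, of "f y"] by (rule SUP_upper)
      finally show "ennreal (cmod (f x - f y)) \<le> (SUP h\<in>C_L1 X ennreal_tm. tm_dist ennreal_tm (h x) (h y))" .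
    qed
  qed
  have C: "topometric_space ?C"
    using compact_topometric_cube by (auto simp: compact_topometric_space_def)
  have inj: "inj_on ?e (tm_space X)"
    by (rule isometric_inj_on[OF top C iso continuous_map_image_subset_topspace[OF e_cont]])
  have "closed_map (tm_top X) (subtopology (tm_top ?C) (?e ` tm_space X)) ?e"
    unfolding closed_map_def
  proof (intro allI impI)
    fix A assume A: "closedin (tm_top X) A"
    define Z where "Z h = {p \<in> tm_space ?C. p h \<in> {0}}" for h
    \<comment> \<open>Inserting the whole space keeps the family nonempty, as
      \<open>closedin_Inter\<close> requires.\<close>
    define \<Z> where "\<Z> = insert (tm_space ?C) (Z ` {h \<in> F. \<forall>a\<in>A. h a = 0})"
    have "closedin (tm_top ?C) (Z h)" if "h \<in> F" for h
      unfolding Z_def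
    proof (rule closedin_continuous_map_preimage)
      show "continuous_map (tm_top ?C) euclidean (\<lambda>p. p h)"
        using continuous_map_product_projection[OF that, of "\<lambda>_. euclidean"] by (simp add: cube_tm_top)
    qed simp
    then have "closedin (tm_top ?C) (\<Inter>\<Z>)"
      by (intro closedin_Inter) (auto simp: \<Z>_def)
    moreover have "?e ` A = \<Inter>\<Z> \<inter> ?e ` tm_space X"
    proof (intro equalityI subsetI)
      fix p assume "p \<in> ?e ` A"
      then obtain a where a: "a \<in> A" "p = ?e a" by blast
      then have "a \<in> tm_space X" using closedin_subset[OF A] by blast
      then have "p \<in> tm_space ?C" "p \<in> ?e ` tm_space X"
        using a continuous_map_image_subset_topspace[OF e_cont] by auto
      then show "p \<in> \<Inter>\<Z> \<inter> ?e ` tm_space X"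
        using a by (auto simp: \<Z>_def Z_def eval_tm_def F_def)
    next
      fix p assume p: "p \<in> \<Inter>\<Z> \<inter> ?e ` tm_space X"
      then obtain x where x: "x \<in> tm_space X" "p = ?e x" by blast
      have "x \<in> A"
      proof (rule ccontr)
        assume "x \<notin> A"
        then obtain f c where f: "f \<in> C_L1 X complex_tm" "\<forall>y\<in>A. f y = c" "f x \<noteq> c"
          using sep A x unfolding separates_points_from_closed_sets_def by blast
        let ?h = "\<lambda>z\<in>tm_space X. ennreal (cmod (f z - c))"
        have "?h \<in> F" using C_L1_cmod_diff[OF f(1)] by (simp add: F_def)
        moreover have "\<forall>a\<in>A. ?h a = 0" using f(2) closedin_subset[OF A] by auto
        ultimately have "p \<in> Z ?h" using p by (auto simp: \<Z>_def)
        then have "?h x = 0" using x \<open>?h \<in> F\<close> by (simp add: Z_def eval_tm_def F_def)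
        then show False using x f(3) by (simp add: ennreal_eq_0_iff)
      qed
      then show "p \<in> ?e ` A" using x by blast
    qed
    ultimately show "closedin (subtopology (tm_top ?C) (?e ` tm_space X)) (?e ` A)"
      by (auto simp: closedin_subtopology)
  qed
  moreover have "continuous_map (tm_top X) (subtopology (tm_top ?C) (?e ` tm_space X)) ?e"
    using e_cont by (simp add: continuous_map_in_subtopology)
  moreover have "?e ` tm_space X = topspace (subtopology (tm_top ?C) (?e ` tm_space X))"
    using continuous_map_image_subset_topspace[OF e_cont] by auto
  ultimately have "embedding_map (tm_top X) (tm_top ?C) ?e"
    unfolding embedding_map_def using inj by (intro bijective_closed_imp_homeomorphic_map)
  with iso show ?thesis by (simp add: tm_embedding_def F_def)
qed

text \<open>The space is the closure of the evaluated \<open>X\<close> in its cube, so density and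
  compactness come with the construction.\<close>

lemma ex_is_beta:
  fixes X :: "'a topometric"
  assumes X: "completely_regular_topometric X"
  shows "\<exists>(B :: (('a \<Rightarrow> ennreal) \<Rightarrow> ennreal) topometric) e. is_beta X B e"
proof -
  let ?C = "cube_tm (C_L1 X ennreal_tm)" and ?e = "eval_tm X"
  define S where "S = tm_top ?C closure_of (?e ` tm_space X)"
  let ?B = "tm_subspace ?C S"
  have emb: "embedding_map (tm_top X) (tm_top ?C) ?e" "isometric_on X ?C ?e"
    using completely_regular_eval_embedding[OF X] unfolding tm_embedding_def by blast+
  have eS: "?e ` tm_space X \<subseteq> S"
    unfolding S_def
    by (rule closure_of_subset[OF continuous_map_image_subset_topspace[OF eval_tm_continuous]])
  have S: "closedin (tm_top ?C) S" unfolding S_def by simp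
  have "embedding_map (tm_top X) (tm_top ?B) ?e"
    using emb eS by (simp add: embedding_map_in_subtopology)
  moreover have "isometric_on X ?B ?e" using emb by (simp add: isometric_on_def)
  moreover have dense: "tm_top ?B closure_of (?e ` tm_space X) = tm_space ?B"
    using eS closedin_subset[OF S] by (simp add: closure_of_subtopology Int_absorb1 flip: S_def)
  ultimately have "tm_compactification X ?B ?e"
    using compact_topometric_subspace[OF compact_topometric_cube S]
    by (simp add: tm_compactification_def tm_embedding_def)
  moreover have "unique_extension_property X ?B ?e ennreal_tm"
    unfolding unique_extension_property_def
  proof
    fix f assume f: "f \<in> C_L1 X ennreal_tm"
    \<comment> \<open>The function \<open>f\<close> is itself an index of the cube, and its
      extension is the coordinate at that index.\<close>
    let ?g = "restrict (\<lambda>p. p f) (tm_space ?B)"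
    have Hausdorff: "Hausdorff_space (euclidean :: ennreal topology)"
      unfolding Hausdorff_space_def disjnt_def
    proof (intro allI impI)
      fix s t :: ennreal
      assume "s \<in> topspace euclidean \<and> t \<in> topspace euclidean \<and> s \<noteq> t"
      then show "\<exists>U V. openin euclidean U \<and> openin euclidean V \<and> s \<in> U \<and> t \<in> V \<and> U \<inter> V = {}"
        using hausdorff[of s t] by simp
    qed
    have "continuous_map (tm_top ?C) euclidean (\<lambda>p. p f)"
      using continuous_map_product_projection[OF f, of "\<lambda>_. euclidean"] by (simp add: cube_tm_top)
    then have "?g \<in> C_L1 ?B ennreal_tm"
      using f by (intro C_L1_restrict) (simp_all add: continuous_map_from_subtopology cube_tm_dist_coordinate)
    moreover have "\<forall>x\<in>tm_space X. ?g (?e x) = f x"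
      using f eS closedin_subset[OF S] by (auto simp: eval_tm_def image_subset_iff)
    moreover have "g1 = g2" if "g1 \<in> C_L1 ?B ennreal_tm \<and> (\<forall>x\<in>tm_space X. g1 (?e x) = f x)"
        "g2 \<in> C_L1 ?B ennreal_tm \<and> (\<forall>x\<in>tm_space X. g2 (?e x) = f x)" for g1 g2
      using that by (intro C_L1_eq_on_dense[OF _ _ _ dense]) (auto simp: Hausdorff)
    ultimately show "\<exists>!g. g \<in> C_L1 ?B ennreal_tm \<and> (\<forall>x\<in>tm_space X. g (?e x) = f x)"
      by blast
  qed
  ultimately show ?thesis unfolding is_beta_def by blast
qed

text \<open>Existence is stated at the concrete type of points of the cube; for the other two claims
  the types of the compactifications and of \<open>Y\<close> are arbitrary type variables.\<close>

theorem theorem2p7: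
  fixes X :: "'a topometric"
  assumes "completely_regular_topometric X"
  shows "(\<exists>(B :: (('a \<Rightarrow> ennreal) \<Rightarrow> ennreal) topometric) e. is_beta X B e) \<and>
    (\<forall>(B :: 'b topometric) e (B' :: 'c topometric) e'.
      is_beta X B e \<and> is_beta X B' e' \<longrightarrow>
      (\<exists>!\<phi>. \<phi> \<in> tm_isomorphisms B B' \<and> (\<forall>x\<in>tm_space X. \<phi> (e x) = e' x))) \<and>
    (\<forall>(B :: 'b topometric) e (Y :: 'd topometric).
      is_beta X B e \<and> compact_topometric_space Y \<longrightarrow> unique_extension_property X B e Y)"
proof (intro conjI allI impI; (elim conjE)?)
  show "\<exists>(B :: (('a \<Rightarrow> ennreal) \<Rightarrow> ennreal) topometric) e. is_beta X B e"
    using assms by (rule ex_is_beta)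
  show "\<exists>!\<phi>. \<phi> \<in> tm_isomorphisms B B' \<and> (\<forall>x\<in>tm_space X. \<phi> (e x) = e' x)"
    if "is_beta X B e" "is_beta X B' e'" for B :: "'b topometric" and e and B' :: "'c topometric" and e'
    using that by (rule is_beta_unique_isomorphism)
  show "unique_extension_property X B e Y"
    if "is_beta X B e" "compact_topometric_space Y" for B :: "'b topometric" and e and Y :: "'d topometric"
    using unique_extension_compact[of X B e Y] that by (simp add: is_beta_def)
qed

end
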